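(* Let $n\ge2$ and let $(k_1,\alpha_1),\dots,(k_n,\alpha_n)$ be an admissible sequence with $k_i\ne k_j$ for all $i\neq j$ in $\{1,\dots,n\}$. Let $\Sigma_n\in\mathbb{R}^{n\times n}$ be the asymptotic covariance matrix in the subcritical regime. Then: (i) $(\Sigma_n)^{1/2}\cdot(\Sigma_n)^{1/2}$ is a Cholesky decomposition of $\Sigma_n$. Additionally, $(\Sigma_n)^{1/2}$ is a matrix root of $\Sigma_n$. (ii) $I_n\cdot\Sigma_n$ is an LU decomposition of $\Sigma_n$, where $I_n$ denotes the $n\times n$ unit matrix.
   Context: $(\Sigma_n)^{1/2}$ denotes the positive semidefinite square root of $\Sigma_n$. A Cholesky decomposition of a matrix $A$ is a factorization $A=GG^t$ with $G$ lower triangular; an LU decomposition is a factorization $A=LU$ with $L$ lower triangular and $U$ upper triangular; a matrix root of $A$ is a matrix $B$ with $B^2=A$. Fix $d\ge 1$ and let $B^d\subset\mathbb{R}^d$ be the unit ball. For $s>0$ and points $x_0,\dots,x_k\in\mathbb{R}^d$ with $k\le d$, $\Delta_s[x_0,\dots,x_k]$ is the $k$-dimensional volume of the convex hull of $x_0,\dots,x_k$ if all edge lengths $\|x_i-x_j\|$ are at most $s$, and $0$ otherwise; for $k>d$ the volume is replaced by $1$. Powers $\Delta_s[\cdot]^\alpha$ are understood to be $0$ when some edge length exceeds $s$. Define $$\mu_k^{(\alpha)}=\int_{(B^d)^k}\Delta_1[0,x_1,\dots,x_k]^\alpha\,dx_1\cdots dx_k.$$ A sequence $(k_1,\alpha_1),\dots,(k_n,\alpha_n)$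 (with $k_i$ integers, $\alpha_i$ real) is admissible if: $0\le k_1\le\dots\le k_n$; the pairs are distinct; $\alpha_i>-d+k_i-1$ and $\alpha_i+\alpha_j>-d+\min_{l\in\{i,j\}}k_l-1$ for all $i,j$; and $\alpha_i=0$ if $k_i>d$. In the subcritical regime ($t\delta_t^d\to0$) the asymptotic covariance matrix of the normalized vector of volume power functionals $(\tilde{\mathcal V}_{k_1}^{(\alpha_1)},\dots,\tilde{\mathcal V}_{k_n}^{(\alpha_n)})$ is $$\Sigma_n=\Big(\mu_{k_j}^{(\alpha_l+\alpha_j)}\frac{\mathbf 1(k_l=k_j)}{(k_j+1)!}\Big)_{l,j=1,\dots,n}.$$ *)

theory Defs
  imports "HOL-Analysis.Analysis" "Jordan_Normal_Form.Matrix"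
begin

section \<open>Simplex volumes and their power integrals\<close>

definition orthonormal_frame :: "nat \<Rightarrow> (nat \<Rightarrow> 'a::euclidean_space) \<Rightarrow> bool" where
  "orthonormal_frame k b \<longleftrightarrow>
     (\<forall>i<k. \<forall>j<k. inner (b i) (b j) = (if i = j then 1 else 0))"

definition frame_point :: "nat \<Rightarrow> 'a::euclidean_space \<Rightarrow> (nat \<Rightarrow> 'a) \<Rightarrow> (nat \<Rightarrow> real) \<Rightarrow> 'a" where
  "frame_point k p b c = p + (\<Sum>i<k. c i *\<^sub>R b i)"

text \<open>The \<open>k\<close>-dimensional volume of a set contained in some \<open>k\<close>-dimensional affine subspace:
  the \<open>k\<close>-dimensional Lebesgue measure of the set in Cartesian coordinates of such a subspace
  (origin \<open>p\<close>, orthonormal directions \<open>b 0, \<dots>, b (k - 1)\<close>). The value does not depend on the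
  chosen coordinates. For \<open>k = 0\<close> it is the counting measure, so a point has volume 1.
  The value is meaningless if the set lies in no \<open>k\<close>-dimensional affine subspace.\<close>

definition k_volume :: "nat \<Rightarrow> 'a::euclidean_space set \<Rightarrow> real" where
  "k_volume k S =
     (let (p, b) = SOME (p, b). orthonormal_frame k b \<and> S \<subseteq> range (frame_point k p b)
      in measure (\<Pi>\<^sub>M i\<in>{..<k}. lborel)
           {c \<in> space (\<Pi>\<^sub>M i\<in>{..<k}. lborel). frame_point k p b c \<in> S})"

definition edges_le :: "real \<Rightarrow> nat \<Rightarrow> (nat \<Rightarrow> real ^ 'd) \<Rightarrow> bool" where
  "edges_le s k x \<longleftrightarrow> (\<forall>i\<le>k. \<forall>j\<le>k. norm (x i - x j) \<le> s)"

definition simplex_vol :: "real \<Rightarrow> nat \<Rightarrow> (nat \<Rightarrow> real ^ 'd) \<Rightarrow> real" where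
  "simplex_vol s k x =
     (if edges_le s k x
      then (if k \<le> CARD('d) then k_volume k (convex hull (x ` {..k})) else 1)
      else 0)"

text \<open>The case \<open>\<alpha> = 0\<close> is separate because \<open>0 powr 0 = 0\<close>, whereas the zeroth power is
  the indicator of all edges having length at most \<open>s\<close>. For \<open>\<alpha> < 0\<close>, degenerate simplices
  get the value 0 instead of infinity; they form a null set.\<close>

definition simplex_vol_power :: "real \<Rightarrow> nat \<Rightarrow> (nat \<Rightarrow> real ^ 'd) \<Rightarrow> real \<Rightarrow> real" where
  "simplex_vol_power s k x \<alpha> =
     (if edges_le s k x then (if \<alpha> = 0 then 1 else simplex_vol s k x powr \<alpha>) else 0)"

text \<open>The type argument fixes the dimension \<open>d = CARD('d)\<close>.\<close>

definition mu :: "'d::finite itself \<Rightarrow> nat \<Rightarrow> real \<Rightarrow> real" where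
  "mu _ k \<alpha> =
     (LINT x : (\<Pi>\<^sub>E i\<in>{1..k}. cball (0 :: real ^ 'd) 1) | (\<Pi>\<^sub>M i\<in>{1..k}. lborel).
        simplex_vol_power 1 k (x(0 := 0)) \<alpha>)"

section \<open>Admissible sequences and the subcritical covariance matrix\<close>

text \<open>Sequences of length \<open>n\<close> are indexed by \<open>0, \<dots>, n - 1\<close>.
  The third and the last clause together imply \<open>k i \<le> d\<close>: for \<open>\<alpha> i = 0\<close> the third one reads
  \<open>k i < d + 1\<close>.\<close>

definition admissible :: "nat \<Rightarrow> nat \<Rightarrow> (nat \<Rightarrow> nat) \<Rightarrow> (nat \<Rightarrow> real) \<Rightarrow> bool" where
  "admissible d n k \<alpha> \<longleftrightarrow>
     (\<forall>i<n. \<forall>j<n. i \<le> j \<longrightarrow> k i \<le> k j) \<and>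
     (\<forall>i<n. \<forall>j<n. i \<noteq> j \<longrightarrow> (k i, \<alpha> i) \<noteq> (k j, \<alpha> j)) \<and>
     (\<forall>i<n. \<alpha> i > - real d + real (k i) - 1) \<and>
     (\<forall>i<n. \<forall>j<n. \<alpha> i + \<alpha> j > - real d + real (min (k i) (k j)) - 1) \<and>
     (\<forall>i<n. k i > d \<longrightarrow> \<alpha> i = 0)"

definition subcritical_cov ::
  "'d::finite itself \<Rightarrow> nat \<Rightarrow> (nat \<Rightarrow> nat) \<Rightarrow> (nat \<Rightarrow> real) \<Rightarrow> real mat" where
  "subcritical_cov D n k \<alpha> =
     mat n n (\<lambda>(l, j). mu D (k j) (\<alpha> l + \<alpha> j) * ((if k l = k j then 1 else 0) / fact (k j + 1)))"

section \<open>Matrix roots and decompositions\<close>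

definition positive_semidefinite :: "real mat \<Rightarrow> bool" where
  "positive_semidefinite A \<longleftrightarrow> square_mat A \<and> transpose_mat A = A \<and>
     (\<forall>v \<in> carrier_vec (dim_row A). scalar_prod v (A *\<^sub>v v) \<ge> 0)"

definition matrix_root :: "real mat \<Rightarrow> real mat \<Rightarrow> bool" where
  "matrix_root A B \<longleftrightarrow> B \<in> carrier_mat (dim_row A) (dim_row A) \<and> B * B = A"

definition psd_sqrt :: "real mat \<Rightarrow> real mat" where
  "psd_sqrt A = (THE B. positive_semidefinite B \<and> matrix_root A B)"

definition lower_triangular :: "real mat \<Rightarrow> bool" where
  "lower_triangular A \<longleftrightarrow> (\<forall>i<dim_row A. \<forall>j<dim_col A. i < j \<longrightarrow> A $$ (i, j) = 0)"

text \<open>\<open>cholesky_decomposition A G H\<close>: the product \<open>G * H\<close> is a Cholesky decomposition of \<open>A\<close>.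
  Likewise for \<open>lu_decomposition\<close>.\<close>

definition cholesky_decomposition :: "real mat \<Rightarrow> real mat \<Rightarrow> real mat \<Rightarrow> bool" where
  "cholesky_decomposition A G H \<longleftrightarrow>
     G \<in> carrier_mat (dim_row A) (dim_row A) \<and> lower_triangular G \<and>
     H = transpose_mat G \<and> A = G * H"

definition lu_decomposition :: "real mat \<Rightarrow> real mat \<Rightarrow> real mat \<Rightarrow> bool" where
  "lu_decomposition A L U \<longleftrightarrow>
     L \<in> carrier_mat (dim_row A) (dim_row A) \<and> U \<in> carrier_mat (dim_row A) (dim_row A) \<and>
     lower_triangular L \<and> upper_triangular U \<and> A = L * U"

end

theory Submission
  imports Defs
begin

text \<open>
  For pairwise distinct \<open>k\<^sub>i\<close> the covariance matrix is diagonal, and its diagonal entries are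
  nonnegative, being integrals of nonnegative functions. The positive semidefinite square root is
  then the entrywise one. For uniqueness, let \<open>B\<close> be another positive semidefinite root of
  \<open>D = R\<^sup>2\<close>. It commutes with \<open>D\<close>, hence with \<open>R\<close>, so that \<open>y = (B - R) v\<close> satisfies
  \<open>y\<^sup>t (B + R) y = y\<^sup>t (B\<^sup>2 - R\<^sup>2) v = 0\<close>. Both summands vanish; thus \<open>R y = 0\<close>,
  \<open>D y = 0\<close> and \<open>\<bar>B y\<bar>\<^sup>2 = y\<^sup>t D y = 0\<close>, which gives \<open>\<bar>y\<bar>\<^sup>2 = v\<^sup>t (B - R) y = 0\<close>.
\<close>

lemma dim_mat_diag [simp]: "dim_row (mat_diag n f) = n" "dim_col (mat_diag n f) = n"
  by (simp_all add: mat_diag_def)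

lemma mat_diag_mult_vec:
  fixes f :: "nat \<Rightarrow> 'a::semiring_0"
  assumes "v \<in> carrier_vec n"
  shows "mat_diag n f *\<^sub>v v = vec n (\<lambda>i. f i * v $ i)"
proof (rule eq_vecI)
  fix i assume "i < dim_vec (vec n (\<lambda>i. f i * v $ i))"
  then have i: "i < n" by simp
  have "(mat_diag n f *\<^sub>v v) $ i = (\<Sum>j\<in>{0..<n}. (if i = j then f j else 0) * v $ j)"
    using i assms by (auto simp: mat_diag_def scalar_prod_def intro!: sum.cong)
  also have "\<dots> = (\<Sum>j\<in>{0..<n}. if i = j then f j * v $ j else 0)"
    by (intro sum.cong) auto
  also have "\<dots> = f i * v $ i" using i by (simp add: sum.delta)
  finally show "(mat_diag n f *\<^sub>v v) $ i = vec n (\<lambda>i. f i * v $ i) $ i" using i by simp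
qed (simp add: mat_diag_def)

lemma scalar_prod_mat_diag_mult_vec:
  fixes f :: "nat \<Rightarrow> 'a::comm_semiring_0"
  assumes "v \<in> carrier_vec n"
  shows "v \<bullet> (mat_diag n f *\<^sub>v v) = (\<Sum>i\<in>{0..<n}. f i * (v $ i * v $ i))"
  using assms by (simp add: mat_diag_mult_vec scalar_prod_def mult.left_commute)

lemma transpose_mat_diag: "transpose_mat (mat_diag n f) = mat_diag n f"
  by (rule eq_matI) (auto simp: mat_diag_def)

text \<open>Lets the symmetric matrices \<open>B\<close> and \<open>R\<close> of the uniqueness
  proof move from one side of a scalar product to the other.\<close>

lemma scalar_prod_symmetric_mat:
  fixes A :: "'a::comm_semiring_0 Matrix.mat"
  assumes A: "A \<in> carrier_mat n n" "transpose_mat A = A"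
    and v: "v \<in> carrier_vec n" and w: "w \<in> carrier_vec n"
  shows "(A *\<^sub>v v) \<bullet> w = v \<bullet> (A *\<^sub>v w)"
  using transpose_vec_mult_scalar[OF A(1) w v] A comm_scalar_prod
  by (metis mult_mat_vec_carrier transpose_carrier_mat v w)

lemma mat_diag_psd:
  fixes r :: "nat \<Rightarrow> real"
  assumes "\<And>i. i < n \<Longrightarrow> 0 \<le> r i"
  shows "positive_semidefinite (mat_diag n r)"
  using assms unfolding positive_semidefinite_def
  by (auto simp: transpose_mat_diag scalar_prod_mat_diag_mult_vec intro!: sum_nonneg)

text \<open>Entry (i, j) of the assumed equation reads
  \<open>B $$ (i, j) * d j = d i * B $$ (i, j)\<close>. So \<open>B\<close> has nonzero entries only
  where \<open>d i = d j\<close>, and there the square roots agree as well.\<close>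

lemma mat_diag_commute_sqrt:
  fixes d :: "nat \<Rightarrow> real"
  assumes B: "B \<in> carrier_mat n n"
    and "B * mat_diag n d = mat_diag n d * B"
  shows "B * mat_diag n (\<lambda>i. sqrt (d i)) = mat_diag n (\<lambda>i. sqrt (d i)) * B"
proof (rule eq_matI)
  fix i j
  assume "i < dim_row (mat_diag n (\<lambda>i. sqrt (d i)) * B)" "j < dim_col (mat_diag n (\<lambda>i. sqrt (d i)) * B)"
  then have ij: "i < n" "j < n" using B by auto
  have "(B * mat_diag n d) $$ (i, j) = (mat_diag n d * B) $$ (i, j)" using assms by simp
  then have "B $$ (i, j) = 0 \<or> d i = d j"
    using ij B by (auto simp: mat_diag_mult_left[OF B] mat_diag_mult_right[OF B])
  then show "(B * mat_diag n (\<lambda>i. sqrt (d i))) $$ (i, j) = (mat_diag n (\<lambda>i. sqrt (d i)) * B) $$ (i, j)"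
    using ij B by (auto simp: mat_diag_mult_left[OF B] mat_diag_mult_right[OF B])
qed (use B in auto)

lemma psd_root_mat_diag_unique:
  fixes d :: "nat \<Rightarrow> real"
  assumes d: "\<And>i. i < n \<Longrightarrow> 0 \<le> d i"
    and psd: "positive_semidefinite B" and root: "matrix_root (mat_diag n d) B"
  shows "B = mat_diag n (\<lambda>i. sqrt (d i))"
proof -
  define R where "R = mat_diag n (\<lambda>i. sqrt (d i))"
  have B: "B \<in> carrier_mat n n" and BB: "B * B = mat_diag n d"
    using root by (auto simp: matrix_root_def)
  have R: "R \<in> carrier_mat n n" by (simp add: R_def)
  have RR: "R * R = mat_diag n d"
    unfolding R_def mat_diag_diag by (rule eq_matI) (auto simp: mat_diag_def d)
  have BT: "transpose_mat B = B" and RT: "transpose_mat R = R"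
    using psd by (auto simp: positive_semidefinite_def R_def transpose_mat_diag)
  have "B * mat_diag n d = mat_diag n d * B"
    unfolding BB[symmetric] using B by (simp add: assoc_mult_mat[of _ n n _ n _ n])
  then have BR: "B * R = R * B"
    unfolding R_def using B by (rule mat_diag_commute_sqrt[rotated])
  have "B *\<^sub>v v = R *\<^sub>v v" if v: "v \<in> carrier_vec n" for v
  proof -
    define y where "y = B *\<^sub>v v - R *\<^sub>v v"
    have Bv: "B *\<^sub>v v \<in> carrier_vec n" and Rv: "R *\<^sub>v v \<in> carrier_vec n"
      using B R v by auto
    then have y: "y \<in> carrier_vec n" by (simp add: y_def)
    then have By: "B *\<^sub>v y \<in> carrier_vec n" and Ry: "R *\<^sub>v y \<in> carrier_vec n"
      using B R by auto
    have "B *\<^sub>v y = B * B *\<^sub>v v - B * R *\<^sub>v v" and "R *\<^sub>v y = R * B *\<^sub>v v - R * R *\<^sub>v v"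
      unfolding y_def using B R v Bv Rv by (auto simp: mult_minus_distrib_mat_vec)
    \<comment> \<open>In the sum of the two expansions the mixed products cancel because
      \<open>B\<close> and \<open>R\<close> commute, and the squares cancel because both equal
      \<open>mat_diag n d\<close>.\<close>
    then have "B *\<^sub>v y + R *\<^sub>v y = 0\<^sub>v n"
      using B R v BB RR BR by (intro eq_vecI) auto
    then have "y \<bullet> (B *\<^sub>v y) + y \<bullet> (R *\<^sub>v y) = 0"
      using y By Ry by (metis scalar_prod_add_distrib scalar_prod_right_zero)
    moreover have "0 \<le> y \<bullet> (B *\<^sub>v y)"
      using psd B y by (auto simp: positive_semidefinite_def)
    moreover have "y \<bullet> (R *\<^sub>v y) = (\<Sum>i\<in>{0..<n}. sqrt (d i) * (y $ i * y $ i))"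
      using y by (simp add: R_def scalar_prod_mat_diag_mult_vec)
    moreover have "0 \<le> (\<Sum>i\<in>{0..<n}. sqrt (d i) * (y $ i * y $ i))"
      using d by (intro sum_nonneg) auto
    ultimately have "(\<Sum>i\<in>{0..<n}. sqrt (d i) * (y $ i * y $ i)) = 0" by linarith
    then have "\<forall>i\<in>{0..<n}. sqrt (d i) * (y $ i * y $ i) = 0"
      using d by (subst (asm) sum_nonneg_eq_0_iff) auto
    \<comment> \<open>A real square root vanishes only at 0, so the same case split annihilates both
      \<open>R\<close> and \<open>mat_diag n d\<close> on \<open>y\<close>.\<close>
    then have dy: "d i = 0 \<or> y $ i = 0" if "i < n" for i using that by auto
    then have R0: "R *\<^sub>v y = 0\<^sub>v n"
      unfolding R_def using y by (intro eq_vecI) (auto simp: mat_diag_mult_vec)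
    have "mat_diag n d *\<^sub>v y = 0\<^sub>v n"
      using y dy by (intro eq_vecI) (auto simp: mat_diag_mult_vec)
    then have "B *\<^sub>v (B *\<^sub>v y) = 0\<^sub>v n"
      using B y BB by (metis assoc_mult_mat_vec)
    then have "(B *\<^sub>v y) \<bullet> (B *\<^sub>v y) = 0"
      using scalar_prod_symmetric_mat[OF B BT y By] y by simp
    \<comment> \<open>Conjugation is the identity on real vectors, so the library fact is plain
      definiteness of the scalar product.\<close>
    then have B0: "B *\<^sub>v y = 0\<^sub>v n" using conjugate_square_eq_0_vec[OF By] by simp
    have "y \<bullet> y = (B *\<^sub>v v) \<bullet> y - (R *\<^sub>v v) \<bullet> y"
      using minus_scalar_prod_distrib[OF Bv Rv y] by (simp add: y_def)
    also have "\<dots> = 0"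
      using v by (simp add: scalar_prod_symmetric_mat[OF B BT v y]
          scalar_prod_symmetric_mat[OF R RT v y] B0 R0)
    finally have "y = 0\<^sub>v n" using conjugate_square_eq_0_vec[OF y] by simp
    then have "(B *\<^sub>v v - R *\<^sub>v v) $ i = 0" if "i < n" for i using that by (simp add: y_def)
    then show ?thesis using Bv Rv B R by (intro eq_vecI) auto
  qed
  \<comment> \<open>Applied to unit vectors, the equality of the two linear maps compares the
    matrices column by column.\<close>
  then have eq: "B *\<^sub>v unit_vec n j = R *\<^sub>v unit_vec n j" for j by simp
  have "B $$ (i, j) = R $$ (i, j)" if "i < n" "j < n" for i j
    using arg_cong[OF eq[of j], of "\<lambda>v. v $ i"] that B R by simp
  then have "B = R" using B R by (intro eq_matI) auto
  then show ?thesis by (simp add: R_def)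
qed

text \<open>The definite description needs existence, witnessed by the entrywise root, and the
  uniqueness just shown.\<close>

lemma psd_sqrt_mat_diag:
  fixes d :: "nat \<Rightarrow> real"
  assumes d: "\<And>i. i < n \<Longrightarrow> 0 \<le> d i"
  shows "psd_sqrt (mat_diag n d) = mat_diag n (\<lambda>i. sqrt (d i))"
  unfolding psd_sqrt_def
proof (rule the_equality)
  have "matrix_root (mat_diag n d) (mat_diag n (\<lambda>i. sqrt (d i)))"
    unfolding matrix_root_def mat_diag_diag using d by (auto simp: mat_diag_def)
  then show "positive_semidefinite (mat_diag n (\<lambda>i. sqrt (d i))) \<and>
      matrix_root (mat_diag n d) (mat_diag n (\<lambda>i. sqrt (d i)))"
    using d by (simp add: mat_diag_psd)
qed (use d psd_root_mat_diag_unique in blast)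

text \<open>The integrand is 0, 1 or a value of \<open>powr\<close>, which is never negative on the
  reals. A divergent integral has the default value 0 and satisfies the bound too.\<close>

lemma mu_nonneg: "0 \<le> mu D k \<alpha>"
  unfolding mu_def set_lebesgue_integral_def simplex_vol_power_def
  by (intro Bochner_Integration.integral_nonneg) auto

text \<open>Off the diagonal the indicator of \<open>k l = k j\<close> vanishes by distinctness; on
  the diagonal it is 1.\<close>

lemma subcritical_cov_eq_mat_diag:
  assumes "\<forall>i<n. \<forall>j<n. i \<noteq> j \<longrightarrow> k i \<noteq> k j"
  shows "subcritical_cov D n k \<alpha> = mat_diag n (\<lambda>j. mu D (k j) (\<alpha> j + \<alpha> j) / fact (k j + 1))"
  unfolding subcritical_cov_def mat_diag_def using assms by (intro eq_matI) auto

theorem theorem5p12: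
  fixes n :: nat and k :: "nat \<Rightarrow> nat" and \<alpha> :: "nat \<Rightarrow> real"
  defines "\<Sigma>\<^sub>n \<equiv> subcritical_cov TYPE('d::finite) n k \<alpha>"
  assumes "n \<ge> 2"
    and "admissible CARD('d) n k \<alpha>"
    and "\<forall>i<n. \<forall>j<n. i \<noteq> j \<longrightarrow> k i \<noteq> k j"
  shows "(cholesky_decomposition \<Sigma>\<^sub>n (psd_sqrt \<Sigma>\<^sub>n) (psd_sqrt \<Sigma>\<^sub>n) \<and> matrix_root \<Sigma>\<^sub>n (psd_sqrt \<Sigma>\<^sub>n))
       \<and> lu_decomposition \<Sigma>\<^sub>n (1\<^sub>m n) \<Sigma>\<^sub>n"
proof -
  define d where "d j = mu TYPE('d) (k j) (\<alpha> j + \<alpha> j) / fact (k j + 1)" for j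
  have \<Sigma>: "\<Sigma>\<^sub>n = mat_diag n d"
    unfolding \<Sigma>\<^sub>n_def d_def by (rule subcritical_cov_eq_mat_diag) fact
  have d: "0 \<le> d j" for j by (simp add: d_def mu_nonneg)
  have sqrt: "psd_sqrt \<Sigma>\<^sub>n = mat_diag n (\<lambda>i. sqrt (d i))"
    unfolding \<Sigma> by (rule psd_sqrt_mat_diag) (rule d)
  have root: "psd_sqrt \<Sigma>\<^sub>n * psd_sqrt \<Sigma>\<^sub>n = \<Sigma>\<^sub>n"
    unfolding sqrt mat_diag_diag by (simp add: \<Sigma> d)
  have lower: "lower_triangular (mat_diag n r)" for r :: "nat \<Rightarrow> real"
    by (auto simp: lower_triangular_def mat_diag_def)
  \<comment> \<open>Being diagonal, the root is lower triangular and equals its own transpose, so it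
    serves as both factors.\<close>
  have "cholesky_decomposition \<Sigma>\<^sub>n (psd_sqrt \<Sigma>\<^sub>n) (psd_sqrt \<Sigma>\<^sub>n)"
    unfolding cholesky_decomposition_def root unfolding sqrt
    by (simp add: \<Sigma> lower transpose_mat_diag)
  moreover have "matrix_root \<Sigma>\<^sub>n (psd_sqrt \<Sigma>\<^sub>n)"
    unfolding matrix_root_def root unfolding sqrt by (simp add: \<Sigma>)
  \<comment> \<open>A diagonal matrix is already upper triangular, which leaves the identity as
    lower factor.\<close>
  moreover have "lu_decomposition \<Sigma>\<^sub>n (1\<^sub>m n) \<Sigma>\<^sub>n"
    unfolding lu_decomposition_def \<Sigma> using lower[of "\<lambda>_. 1"]
    by (auto simp: mat_diag_def upper_triangular_def lower_triangular_def)
  ultimately show ?thesis by blast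
qed

end
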